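(* Let $T$ be a tree and let $\ell\in\{1,2,3\}$. Then $\chi_s'(T\Box C_{2\ell+1})\le 2\Delta(T)+\left\lceil \frac{\Delta(T)}{\ell}\right\rceil+6$, where $C_{2\ell+1}$ is the cycle of length $2\ell+1$.
   Context: $\Delta(T)$ is the maximum degree of $T$. The Cartesian product $G\Box H$ has vertex set $V(G)\times V(H)$, with $(a,u)\sim(b,v)$ iff either $a=b$ and $uv\in E(H)$, or $u=v$ and $ab\in E(G)$. A strong edge coloring is a proper edge coloring in which every color class is an induced matching; $\chi_s'(G)$ is the minimum number of colors in such a coloring. *)

theory Defs
  imports Complex_Main "Graph_Theory.Graph_Theory"
begin

text \<open>
  A finite simple graph is a \<^locale>\<open>pair_graph\<close>: a finite, loopfree, symmetric relation on a
  finite vertex set. The undirected edge $uv$ is the set of endpoints of the two opposite arcs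
  $(u,v)$ and $(v,u)$.
\<close>

definition uedges :: "'a pair_pre_digraph \<Rightarrow> 'a set set" where
  "uedges G = {{u, v} | u v. (u, v) \<in> parcs G}"

text \<open>
  The library constant \<^const>\<open>tree\<close> cannot be used here: in a symmetric digraph $u,v,u$ already
  counts as a \<^const>\<open>pre_digraph.cycle\<close>, so no graph with an edge satisfies it. In a simple graph
  the cycles of the undirected graph are precisely the library cycles of length at least 3.
  Connectedness includes that there is at least one vertex.
\<close>

definition undirected_tree :: "'a pair_pre_digraph \<Rightarrow> bool" where
  "undirected_tree G \<longleftrightarrow>
     pair_graph G \<and> Digraph_Component.connected (with_proj G) \<and>
     \<not> (\<exists>p. pre_digraph.cycle (with_proj G) p \<and> 3 \<le> length p)"

text \<open>In a symmetric digraph the out-degree of a vertex is its degree as a graph.\<close>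

definition max_degree :: "'a pair_pre_digraph \<Rightarrow> nat" where
  "max_degree G = Max (out_degree (with_proj G) ` pverts G)"

text \<open>This is the cycle graph only for \<open>n \<ge> 3\<close>.\<close>

definition cycle_graph :: "nat \<Rightarrow> nat pair_pre_digraph" where
  "cycle_graph n =
     \<lparr> pverts = {..<n},
       parcs = {(i, j). i < n \<and> j < n \<and> (j = Suc i mod n \<or> i = Suc j mod n)} \<rparr>"

definition cartesian_product ::
    "'a pair_pre_digraph \<Rightarrow> 'b pair_pre_digraph \<Rightarrow> ('a \<times> 'b) pair_pre_digraph"
    (infixr \<open>\<box>\<close> 70) where
  "G \<box> H =
     \<lparr> pverts = pverts G \<times> pverts H,
       parcs = {((a, u), (b, v)). a \<in> pverts G \<and> b \<in> pverts G \<and> u \<in> pverts H \<and> v \<in> pverts H \<and>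
                  (a = b \<and> (u, v) \<in> parcs H \<or> u = v \<and> (a, b) \<in> parcs G)} \<rparr>"

definition matching :: "'a pair_pre_digraph \<Rightarrow> 'a set set \<Rightarrow> bool" where
  "matching G M \<longleftrightarrow> M \<subseteq> uedges G \<and> (\<forall>e\<in>M. \<forall>e'\<in>M. e \<noteq> e' \<longrightarrow> e \<inter> e' = {})"

text \<open>
  A matching is induced if the subgraph induced by the set \<open>\<Union>M\<close> of its endpoints has no edges
  other than those in \<open>M\<close>.
\<close>

definition induced_matching :: "'a pair_pre_digraph \<Rightarrow> 'a set set \<Rightarrow> bool" where
  "induced_matching G M \<longleftrightarrow> matching G M \<and> {e \<in> uedges G. e \<subseteq> \<Union>M} = M"

definition proper_edge_coloring :: "'a pair_pre_digraph \<Rightarrow> ('a set \<Rightarrow> 'c) \<Rightarrow> bool" where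
  "proper_edge_coloring G f \<longleftrightarrow>
     (\<forall>e\<in>uedges G. \<forall>e'\<in>uedges G. e \<noteq> e' \<and> e \<inter> e' \<noteq> {} \<longrightarrow> f e \<noteq> f e')"

definition strong_edge_coloring :: "'a pair_pre_digraph \<Rightarrow> ('a set \<Rightarrow> 'c) \<Rightarrow> bool" where
  "strong_edge_coloring G f \<longleftrightarrow>
     proper_edge_coloring G f \<and> (\<forall>c. induced_matching G {e \<in> uedges G. f e = c})"

definition strong_chromatic_index :: "'a pair_pre_digraph \<Rightarrow> nat" where
  "strong_chromatic_index G =
     (LEAST k. \<exists>f :: 'a set \<Rightarrow> nat. strong_edge_coloring G f \<and> f ` uedges G \<subseteq> {..<k})"

text \<open>
  The objects above are finite simple graphs, and every finite simple graph has a strong edge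
  coloring, so that the minimum in \<^const>\<open>strong_chromatic_index\<close> is taken over a nonempty set.
\<close>

lemma pair_graph_cycle_graph:
  assumes "3 \<le> n"
  shows "pair_graph (cycle_graph n)"
proof
  show "finite (parcs (cycle_graph n))"
    by (rule finite_subset[of _ "{..<n} \<times> {..<n}"]) (auto simp: cycle_graph_def)
  show "symmetric (with_proj (cycle_graph n))"
    by (auto simp: symmetric_def cycle_graph_def intro!: symI)
  fix e assume "e \<in> parcs (cycle_graph n)"
  then show "fst e \<noteq> snd e"
    using assms by (auto simp: cycle_graph_def mod_Suc split: if_splits)
qed (auto simp: cycle_graph_def)

lemma pair_graph_cartesian_product:
  assumes "pair_graph G" and "pair_graph H"
  shows "pair_graph (G \<box> H)"
proof -
  interpret G: pair_graph G by fact
  interpret H: pair_graph H by fact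
  show ?thesis
  proof
    show "finite (parcs (G \<box> H))"
      by (rule finite_subset[of _ "(pverts G \<times> pverts H) \<times> (pverts G \<times> pverts H)"])
        (auto simp: cartesian_product_def)
    have "sym (parcs G)" "sym (parcs H)"
      using G.sym_arcs H.sym_arcs by (auto simp: symmetric_def)
    then show "symmetric (with_proj (G \<box> H))"
      by (auto simp: symmetric_def cartesian_product_def sym_def)
    fix e assume "e \<in> parcs (G \<box> H)"
    then show "fst e \<noteq> snd e"
      using G.pair_no_loops H.pair_no_loops by (fastforce simp: cartesian_product_def)
  qed (auto simp: cartesian_product_def)
qed

lemma strong_edge_coloring_exists:
  assumes "pair_graph G"
  shows "\<exists>k. \<exists>f :: 'a set \<Rightarrow> nat. strong_edge_coloring (G :: 'a pair_pre_digraph) f \<and>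
           f ` uedges G \<subseteq> {..<k}"
proof -
  interpret pair_graph G by fact
  have "uedges G = (\<lambda>(u, v). {u, v}) ` parcs G"
    by (auto simp: uedges_def)
  then have fin: "finite (uedges G)"
    by simp
  then obtain f :: "'a set \<Rightarrow> nat" where inj: "inj_on f (uedges G)"
    by (meson finite_imp_inj_to_nat_seg)
  have ends: "\<exists>u v. e = {u, v} \<and> u \<noteq> v" if "e \<in> uedges G" for e
    using that pair_no_loops by (fastforce simp: uedges_def)
  have sub: "e = e'" if "e \<in> uedges G" "e' \<in> uedges G" "e \<subseteq> e'" for e e'
    using ends[OF that(1)] ends[OF that(2)] that(3) by auto
  have single: "induced_matching G {e}" if "e \<in> uedges G" for e
    using that sub by (auto simp: induced_matching_def matching_def)
  have empty: "induced_matching G {}"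
    using ends by (fastforce simp: induced_matching_def matching_def)
  have "induced_matching G {e \<in> uedges G. f e = c}" for c
  proof (cases "\<exists>e\<in>uedges G. f e = c")
    case True
    then obtain e where "e \<in> uedges G" "f e = c" by auto
    moreover from this have "{e \<in> uedges G. f e = c} = {e}"
      using inj by (auto dest: inj_onD)
    ultimately show ?thesis using single by simp
  next
    case False
    then have "{e \<in> uedges G. f e = c} = {}" by auto
    then show ?thesis using empty by (simp only:)
  qed
  moreover have "proper_edge_coloring G f"
    using inj by (auto simp: proper_edge_coloring_def dest: inj_onD)
  moreover have "f ` uedges G \<subseteq> {..<Suc (Max (f ` uedges G))}"
    using fin by (auto simp: less_Suc_eq_le)
  ultimately show ?thesis
    unfolding strong_edge_coloring_def by blast
qed

end

theory Submission
  imports Defs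
begin

text \<open>
  The fibre edges get six colours of their own: a fixed pair of strong edge colourings of the cycle,
  used alternately along the tree. For the edges parallel to the tree, fix a proper edge colouring
  \<open>\<iota>\<close> of \<open>T\<close> with \<open>d\<close> indices and give every vertex \<open>a\<close> a star \<open>c\<^sub>a\<close>, where \<open>c\<^sub>a i u\<close> is the
  colour of the edge with index \<open>i\<close> at \<open>a\<close> in layer \<open>u\<close>. The colouring is strong if the colour sets
  of \<open>c\<^sub>a\<close> in adjacent layers are disjoint and the stars of adjacent vertices \<open>a\<close>, \<open>b\<close> share in each
  layer only the colour of \<open>ab\<close>. So it suffices to have a set of stars in which every star has, for
  every index, a partner of the latter kind; the tree is then labelled vertex by vertex.

  With \<open>d = g\<close> and \<open>2 g + 1\<close> colours, such sets exist on the cycle of length \<open>2 g + 1\<close> for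
  \<open>g \<le> 3\<close>: take the orbit of one star under symmetries of the cycle and of the colours. They pull
  back to longer odd cycles, and stars over disjoint sets of indices and colours can be juxtaposed,
  since rotating a star by one layer makes it disjoint from itself. Cutting \<open>d\<close> indices into
  \<open>\<lceil>d / l\<rceil>\<close> groups of size at most \<open>l\<close> uses \<open>2 d + \<lceil>d / l\<rceil>\<close> colours.
\<close>

section \<open>Induction and labellings on trees\<close>

text \<open>Connectedness of the subgraph induced by \<open>W\<close>, phrased with simple paths of
  \<open>G\<close> that stay in \<open>W\<close>, so that such a path can be closed to a cycle of
  \<open>G\<close> itself.\<close>

definition linked_within :: "'a pair_pre_digraph \<Rightarrow> 'a set \<Rightarrow> bool" where
  "linked_within G W \<longleftrightarrow>
     (\<forall>x\<in>W. \<forall>y\<in>W. \<exists>p. pre_digraph.apath (with_proj G) x p y \<and>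
        set (pre_digraph.awalk_verts (with_proj G) x p) \<subseteq> W)"

text \<open>A tree grows from \<open>r\<close> by one leaf at a time. A maximal linked
  \<open>W\<close> satisfying \<open>P\<close> is everything: otherwise an arc leaves
  \<open>W\<close> to some \<open>a\<close>, and a second neighbour of \<open>a\<close> in
  \<open>W\<close> would close a cycle.\<close>

lemma undirected_tree_induct [consumes 2, case_names base step]:
  assumes T: "undirected_tree T" and r: "r \<in> pverts T"
    and base: "P {r}"
    and step: "\<And>W p a. W \<subseteq> pverts T \<Longrightarrow> p \<in> W \<Longrightarrow> a \<in> pverts T \<Longrightarrow> a \<notin> W \<Longrightarrow> (p, a) \<in> parcs T \<Longrightarrow>
      (\<And>q. q \<in> W \<Longrightarrow> (q, a) \<in> parcs T \<Longrightarrow> q = p) \<Longrightarrow> P W \<Longrightarrow> P (insert a W)"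
  shows "P (pverts T)"
proof -
  interpret pair_graph T using T by (simp add: undirected_tree_def)
  have arc_sym: "(y, x) \<in> parcs T" if "(x, y) \<in> parcs T" for x y
    using that sym_arcs by (auto simp: symmetric_def sym_def)
  define Ws where "Ws = {W. W \<subseteq> pverts T \<and> r \<in> W \<and> linked_within T W \<and> P W}"
  have "finite Ws"
    by (rule finite_subset[of _ "Pow (pverts T)"]) (auto simp: Ws_def)
  moreover have "linked_within T {r}"
    using r by (auto simp: linked_within_def apath_Nil_iff intro!: exI[of _ "[]"])
  then have "{r} \<in> Ws"
    using r base by (simp add: Ws_def)
  ultimately obtain W where W: "W \<in> Ws" and max: "\<And>W'. W' \<in> Ws \<Longrightarrow> W \<subseteq> W' \<Longrightarrow> W' = W"
    using finite_has_maximal[of Ws] by blast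
  have "W = pverts T"
  proof (rule ccontr)
    assume "W \<noteq> pverts T"
    then obtain x where x: "x \<in> pverts T" "x \<notin> W"
      using W by (auto simp: Ws_def)
    have "r \<rightarrow>\<^sup>*\<^bsub>with_proj T\<^esub> x"
      using T r x symmetric_connected_imp_strongly_connected[OF sym_arcs]
      by (auto simp: undirected_tree_def)
    \<comment> \<open>A walk from \<open>r\<close> to \<open>x\<close> starts inside
      \<open>W\<close> and ends outside it, so one of its arcs leaves \<open>W\<close>.\<close>
    then have "x \<in> W \<or> (\<exists>p a. p \<in> W \<and> a \<notin> W \<and> (p, a) \<in> parcs T)"
    proof (induct rule: reachable_induct)
      case base
      then show ?case using W by (simp add: Ws_def)
    next
      case (step x y)
      then show ?case by auto
    qed
    then obtain p a where pa: "p \<in> W" "a \<notin> W" "(p, a) \<in> parcs T"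
      using x by auto
    have a: "a \<in> pverts T"
      using wellformed[OF pa(3)] by simp
    have path: "\<exists>p. apath x p y \<and> set (awalk_verts x p) \<subseteq> W" if "x \<in> W" "y \<in> W" for x y
      using W that by (auto simp: Ws_def linked_within_def)
    have unique: "q = p" if q: "q \<in> W" "(q, a) \<in> parcs T" for q
    proof (rule ccontr)
      assume "q \<noteq> p"
      obtain ps where ps: "apath p ps q" "set (awalk_verts p ps) \<subseteq> W"
        using path[OF pa(1) q(1)] by blast
      with \<open>q \<noteq> p\<close> have "ps \<noteq> []" by (auto simp: apath_Nil_iff)
      have "awalk p (ps @ [(q, a)]) a"
        using ps q a by (auto simp: apath_def awalk_simps)
      \<comment> \<open>The path from \<open>p\<close> to \<open>q\<close> avoids \<open>a\<close>
        because it stays in \<open>W\<close>; as it is nonempty, the closed walk through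
        \<open>a\<close> has at least three arcs.\<close>
      then have "cycle ((a, p) # ps @ [(q, a)])"
        unfolding cycle_def
        using ps pa arc_sym[OF pa(3)] awalk_verts_append[of p ps "[(q, a)]" a]
        by (auto intro!: exI[of _ a] simp: apath_def awalk_Cons_iff)
      moreover have "3 \<le> length ((a, p) # ps @ [(q, a)])"
        using \<open>ps \<noteq> []\<close> by (simp add: Suc_le_eq)
      ultimately show False
        using T unfolding undirected_tree_def by blast
    qed
    have "\<exists>ps. apath x ps y \<and> set (awalk_verts x ps) \<subseteq> insert a W"
      if "x \<in> insert a W" "y \<in> insert a W" for x y
    proof -
      consider "x \<in> W" "y \<in> W" | "x = a" "y = a" | "x = a" "y \<in> W" | "x \<in> W" "y = a"
        using \<open>x \<in> insert a W\<close> \<open>y \<in> insert a W\<close> by auto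
      then show ?thesis
      proof cases
        case 1
        then show ?thesis using path by blast
      next
        case 2
        then show ?thesis
          using a by (intro exI[of _ "[]"]) (auto simp: apath_Nil_iff)
      next
        case 3
        obtain ps where ps: "apath p ps y" "set (awalk_verts p ps) \<subseteq> W"
          using path[OF pa(1) 3(2)] by blast
        then show ?thesis
          using 3 pa arc_sym[OF pa(3)]
          by (intro exI[of _ "(a, p) # ps"]) (auto simp: apath_Cons_iff)
      next
        case 4
        obtain ps where ps: "apath x ps p" "set (awalk_verts x ps) \<subseteq> W"
          using path[OF 4(1) pa(1)] by blast
        have "awalk x (ps @ [(p, a)]) a"
          using ps pa a by (auto simp: apath_def awalk_simps)
        then show ?thesis
          using ps 4 pa awalk_verts_append[of x ps "[(p, a)]" a]
          by (intro exI[of _ "ps @ [(p, a)]"]) (auto simp: apath_def)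
      qed
    qed
    then have "linked_within T (insert a W)"
      by (simp add: linked_within_def)
    moreover have "P (insert a W)"
      using W by (intro step[OF _ pa(1) a pa(2,3) unique]) (auto simp: Ws_def)
    ultimately have "insert a W \<in> Ws"
      using W a by (simp add: Ws_def)
    then show False using max[of "insert a W"] pa by auto
  qed
  then show ?thesis using W by (simp add: Ws_def)
qed

text \<open>Greedy labelling: a new leaf \<open>a\<close> has a single neighbour \<open>p\<close> in
  \<open>W\<close>, so only the arc between them constrains its label. Any index still free at
  \<open>p\<close> serves, and \<Sigma> contains a partner of the label of \<open>p\<close> for that
  index.\<close>

lemma tree_labelling:
  assumes T: "undirected_tree T" and d: "max_degree T \<le> d" and \<Sigma>: "\<Sigma> \<noteq> {}"
    and R: "\<And>s i. s \<in> \<Sigma> \<Longrightarrow> i < d \<Longrightarrow> \<exists>s'\<in>\<Sigma>. R i s s'"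
    and R_sym: "\<And>i s s'. R i s s' \<Longrightarrow> R i s' s"
  obtains \<sigma> :: "'a \<Rightarrow> 's" and \<iota> :: "'a \<Rightarrow> 'a \<Rightarrow> nat" where
    "\<And>a. a \<in> pverts T \<Longrightarrow> \<sigma> a \<in> \<Sigma>"
    "\<And>a b. (a, b) \<in> parcs T \<Longrightarrow> \<iota> a b < d \<and> \<iota> b a = \<iota> a b \<and> R (\<iota> a b) (\<sigma> a) (\<sigma> b)"
    "\<And>a b b'. (a, b) \<in> parcs T \<Longrightarrow> (a, b') \<in> parcs T \<Longrightarrow> \<iota> a b = \<iota> a b' \<Longrightarrow> b = b'"
proof -
  interpret pair_graph T using T by (simp add: undirected_tree_def)
  have arc_sym: "(y, x) \<in> parcs T" if "(x, y) \<in> parcs T" for x y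
    using that sym_arcs by (auto simp: symmetric_def sym_def)
  have no_loop: "(x, x) \<notin> parcs T" for x
    using pair_no_loops by fastforce
  define labels where "labels \<sigma> \<iota> W \<longleftrightarrow> (\<forall>a\<in>W. \<sigma> a \<in> \<Sigma> \<and>
      (\<forall>b\<in>W. (a, b) \<in> parcs T \<longrightarrow> \<iota> a b < d \<and> \<iota> b a = \<iota> a b \<and> R (\<iota> a b) (\<sigma> a) (\<sigma> b) \<and>
        (\<forall>b'\<in>W. (a, b') \<in> parcs T \<longrightarrow> \<iota> a b = \<iota> a b' \<longrightarrow> b = b')))"
    for \<sigma> :: "'a \<Rightarrow> 's" and \<iota> :: "'a \<Rightarrow> 'a \<Rightarrow> nat" and W
  obtain r where r: "r \<in> pverts T"
    using T by (auto simp: undirected_tree_def connected_conv)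
  have "\<exists>\<sigma> \<iota>. labels \<sigma> \<iota> (pverts T)"
    using T r
  proof (induct rule: undirected_tree_induct)
    case base
    obtain s where "s \<in> \<Sigma>" using \<Sigma> by blast
    then show ?case
      by (intro exI[of _ "\<lambda>_. s"]) (simp add: labels_def no_loop)
  next
    case (step W p a)
    then obtain \<sigma> \<iota> where lab: "labels \<sigma> \<iota> W" by blast
    have lab_mem: "\<sigma> x \<in> \<Sigma>" if "x \<in> W" for x
      using lab that unfolding labels_def by blast
    have lab_arc: "\<iota> x y < d" "\<iota> y x = \<iota> x y" "R (\<iota> x y) (\<sigma> x) (\<sigma> y)"
      if "x \<in> W" "y \<in> W" "(x, y) \<in> parcs T" for x y
      using lab that unfolding labels_def by blast+
    have lab_inj: "y = z"
      if "x \<in> W" "y \<in> W" "z \<in> W" "(x, y) \<in> parcs T" "(x, z) \<in> parcs T" "\<iota> x y = \<iota> x z" for x y z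
      using lab that unfolding labels_def by blast
    let ?N = "{b \<in> W. (p, b) \<in> parcs T}"
    have fin: "finite W"
      using finite_subset[OF step(1)] by simp
    \<comment> \<open>The neighbour \<open>a\<close> of \<open>p\<close> lies outside
      \<open>W\<close>, so \<open>p\<close> has fewer than \<open>d\<close> neighbours inside
      \<open>W\<close> and an index is left over.\<close>
    have "card (insert a ?N) \<le> card (out_arcs (with_proj T) p)"
    proof (rule card_inj_on_le)
      show "inj_on (Pair p) (insert a ?N)"
        by (simp add: inj_on_def)
      show "Pair p ` insert a ?N \<subseteq> out_arcs (with_proj T) p"
        using step(5) by (auto simp: out_arcs_def)
    qed (rule finite_out_arcs)
    also have "\<dots> \<le> max_degree T"
      unfolding max_degree_def out_degree_def[symmetric] using step(1,2) by (intro Max_ge) auto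
    finally have "card ?N < d"
      using d fin step(4) by simp
    then have "card (\<iota> p ` ?N) < card {..<d}"
      using fin by (simp add: le_less_trans[OF card_image_le])
    then have "\<not> {..<d} \<subseteq> \<iota> p ` ?N"
      using fin card_mono[of "\<iota> p ` ?N" "{..<d}"] by auto
    then obtain i where i: "i < d" "i \<notin> \<iota> p ` ?N"
      by blast
    obtain s where s: "s \<in> \<Sigma>" "R i (\<sigma> p) s"
      using R[OF lab_mem[OF step(2)] i(1)] by blast
    define \<iota>' where "\<iota>' x y = (if x = p \<and> y = a \<or> x = a \<and> y = p then i else \<iota> x y)" for x y
    have only: "q = p" if "q \<in> W" "(q, a) \<in> parcs T \<or> (a, q) \<in> parcs T" for q
      using that step(6) arc_sym by blast
    have old: "\<iota>' x y = \<iota> x y" if "x \<in> W" "y \<in> W" for x y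
      using that step(4) by (auto simp: \<iota>'_def)
    have new: "\<iota>' p a = i" "\<iota>' a p = i"
      by (simp_all add: \<iota>'_def)
    have "labels (\<sigma>(a := s)) \<iota>' (insert a W)"
      unfolding labels_def
    proof (intro ballI conjI impI)
      fix x assume x: "x \<in> insert a W"
      show "(\<sigma>(a := s)) x \<in> \<Sigma>"
        using x s lab_mem by auto
      fix y assume y: "y \<in> insert a W" and xy: "(x, y) \<in> parcs T"
      have "x \<in> W \<and> y \<in> W \<or> x = p \<and> y = a \<or> x = a \<and> y = p"
        using x y xy only[of x] only[of y] no_loop[of a] by auto
      then consider "x \<in> W" "y \<in> W" "x \<noteq> a" "y \<noteq> a" | "x = p" "y = a" | "x = a" "y = p"
        using step(4) by metis
      note cases = this
      show "\<iota>' x y < d"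
        using cases
      proof cases
        case 1
        then show ?thesis using lab_arc(1)[OF 1(1,2) xy] by (simp add: old)
      qed (simp_all add: new i(1))
      show "\<iota>' y x = \<iota>' x y"
        using cases
      proof cases
        case 1
        then show ?thesis using lab_arc(2)[OF 1(1,2) xy] by (simp add: old)
      qed (simp_all add: new)
      show "R (\<iota>' x y) ((\<sigma>(a := s)) x) ((\<sigma>(a := s)) y)"
        using cases
      proof cases
        case 1
        then show ?thesis using lab_arc(3)[OF 1(1,2) xy] by (simp add: old)
      next
        case 2
        then show ?thesis using s no_loop xy by (auto simp: new)
      next
        case 3
        then show ?thesis using R_sym[OF s(2)] no_loop xy by (auto simp: new)
      qed
      fix z assume z: "z \<in> insert a W" and xz: "(x, z) \<in> parcs T" and eq: "\<iota>' x y = \<iota>' x z"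
      show "y = z"
      proof (cases "x = a")
        case True
        then show ?thesis
          using y z xy xz only[of y] only[of z] no_loop[of a] by auto
      next
        case False
        then have "x \<in> W" using x by simp
        have fresh: "\<iota>' x w \<noteq> i" if "w \<in> W" "(x, w) \<in> parcs T" "x = p" for w
          using i(2) that step(2) by (auto simp: old)
        show ?thesis
        proof (cases "y = a \<or> z = a")
          case True
          then have "x = p" using only[of x] \<open>x \<in> W\<close> xy xz by auto
          then have "y = a \<longleftrightarrow> z = a"
            using eq y z xy xz fresh[of y] fresh[of z] new by auto
          then show ?thesis using True by blast
        next
          case False
          then show ?thesis
            using lab_inj[OF \<open>x \<in> W\<close> _ _ xy xz] \<open>x \<in> W\<close> y z eq by (simp add: old)
        qed
      qed
    qed
    then show ?case by blast
  qed
  then obtain \<sigma> \<iota> where lab: "labels \<sigma> \<iota> (pverts T)" by blast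
  have verts: "a \<in> pverts T" "b \<in> pverts T" if "(a, b) \<in> parcs T" for a b
    using wellformed[OF that] by auto
  show ?thesis
  proof (rule that)
    show "\<sigma> a \<in> \<Sigma>" if "a \<in> pverts T" for a
      using lab that unfolding labels_def by blast
    show "\<iota> a b < d \<and> \<iota> b a = \<iota> a b \<and> R (\<iota> a b) (\<sigma> a) (\<sigma> b)" if "(a, b) \<in> parcs T" for a b
      using lab that verts[OF that] unfolding labels_def by blast
    show "b = b'" if "(a, b) \<in> parcs T" "(a, b') \<in> parcs T" "\<iota> a b = \<iota> a b'" for a b b'
      using lab that verts[OF that(1)] verts[OF that(2)] unfolding labels_def by blast
  qed
qed

section \<open>Systems of stars\<close>

definition star :: "'b pair_pre_digraph \<Rightarrow> nat \<Rightarrow> nat \<Rightarrow> (nat \<Rightarrow> 'b \<Rightarrow> nat) \<Rightarrow> bool" where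
  "star H d k c \<longleftrightarrow>
     (\<forall>u\<in>pverts H. \<forall>i<d. c i u < k \<and> (\<forall>j<d. c i u = c j u \<longrightarrow> i = j)) \<and>
     (\<forall>(u, v)\<in>parcs H. \<forall>i<d. \<forall>j<d. c i u \<noteq> c j v)"

definition linked ::
    "'b pair_pre_digraph \<Rightarrow> nat \<Rightarrow> nat \<Rightarrow> (nat \<Rightarrow> 'b \<Rightarrow> nat) \<Rightarrow> (nat \<Rightarrow> 'b \<Rightarrow> nat) \<Rightarrow> bool" where
  "linked H d i c c' \<longleftrightarrow>
     (\<forall>u\<in>pverts H. \<forall>j<d. \<forall>j'<d. c j u = c' j' u \<longleftrightarrow> j = i \<and> j' = i)"

text \<open>Used when stars are juxtaposed: along a tree edge whose index lies in one block, the two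
  stars must share no colour at all in the other block.\<close>

definition unlinked ::
    "'b pair_pre_digraph \<Rightarrow> nat \<Rightarrow> (nat \<Rightarrow> 'b \<Rightarrow> nat) \<Rightarrow> (nat \<Rightarrow> 'b \<Rightarrow> nat) \<Rightarrow> bool" where
  "unlinked H d c c' \<longleftrightarrow> (\<forall>u\<in>pverts H. \<forall>j<d. \<forall>j'<d. c j u \<noteq> c' j' u)"

definition star_system :: "'b pair_pre_digraph \<Rightarrow> nat \<Rightarrow> nat \<Rightarrow> (nat \<Rightarrow> 'b \<Rightarrow> nat) set \<Rightarrow> bool" where
  "star_system H d k \<Sigma> \<longleftrightarrow> \<Sigma> \<noteq> {} \<and>
     (\<forall>c\<in>\<Sigma>. star H d k c \<and> (\<exists>c'\<in>\<Sigma>. unlinked H d c c') \<and> (\<forall>i<d. \<exists>c'\<in>\<Sigma>. linked H d i c c'))"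

definition graph_hom :: "'a pair_pre_digraph \<Rightarrow> 'b pair_pre_digraph \<Rightarrow> ('a \<Rightarrow> 'b) \<Rightarrow> bool" where
  "graph_hom G H h \<longleftrightarrow>
     h ` pverts G \<subseteq> pverts H \<and> (\<forall>(u, v)\<in>parcs G. (h u, h v) \<in> parcs H)"

lemma linked_sym: "linked H d i c c' \<Longrightarrow> linked H d i c' c"
  unfolding linked_def by metis

lemma star_system_empty: "star_system H 0 0 UNIV"
  by (simp add: star_system_def star_def linked_def unlinked_def)

section \<open>Juxtaposition over disjoint index and colour blocks\<close>

definition juxtapose ::
    "nat \<Rightarrow> nat \<Rightarrow> (nat \<Rightarrow> 'b \<Rightarrow> nat) \<Rightarrow> (nat \<Rightarrow> 'b \<Rightarrow> nat) \<Rightarrow> nat \<Rightarrow> 'b \<Rightarrow> nat" where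
  "juxtapose d k c c' i u = (if i < d then c i u else k + c' (i - d) u)"

lemma less_add_cases:
  fixes i :: nat
  assumes "i < d + d'"
  obtains "i < d" | i' where "i = d + i'" "i' < d'"
  using assms by (metis add.commute less_diff_conv2 linorder_not_less le_add_diff_inverse)

lemma starD:
  assumes "star H d k c" "i < d" "j < d"
  shows star_less: "u \<in> pverts H \<Longrightarrow> c i u < k"
    and star_eq_iff: "u \<in> pverts H \<Longrightarrow> c i u = c j u \<longleftrightarrow> i = j"
    and star_adj: "(u, v) \<in> parcs H \<Longrightarrow> c i u \<noteq> c j v"
  using assms by (auto simp: star_def)

text \<open>Colours of the first block are below \<open>k\<close> and those of the second at least
  \<open>k\<close>, so every condition reduces to one inside a single block.\<close>

lemma star_juxtapose:
  assumes "pair_graph H" "star H d k c" "star H d' k' c'"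
  shows "star H (d + d') (k + k') (juxtapose d k c c')"
proof -
  interpret pair_graph H by fact
  note c = starD[OF assms(2)] and c' = starD[OF assms(3)]
  have ne: "c i u \<noteq> k + x" if "u \<in> pverts H" "i < d" for i u x
    using c(1)[OF that(2,2,1)] by simp
  show ?thesis
    unfolding star_def
  proof (intro conjI ballI allI impI)
    fix u i assume u: "u \<in> pverts H" and i: "i < d + d'"
    show "juxtapose d k c c' i u < k + k'"
      using i by (rule less_add_cases) (auto simp: juxtapose_def c(1) c'(1) u trans_less_add1)
    fix j assume j: "j < d + d'" and eq: "juxtapose d k c c' i u = juxtapose d k c c' j u"
    show "i = j"
      using i
    proof (rule less_add_cases)
      assume "i < d"
      then show ?thesis
        using eq j u by (elim less_add_cases) (auto simp: juxtapose_def c(2) ne)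
    next
      fix i' assume "i = d + i'" "i' < d'"
      then show ?thesis
        using eq j u by (elim less_add_cases) (auto simp: juxtapose_def c'(2) ne[symmetric])
    qed
  next
    fix e assume "e \<in> parcs H"
    then obtain u v where e: "e = (u, v)" and uv: "(u, v) \<in> parcs H" "u \<in> pverts H" "v \<in> pverts H"
      using wellformed[of e] by (cases e) auto
    have "juxtapose d k c c' i u \<noteq> juxtapose d k c c' j v" if i: "i < d + d'" and j: "j < d + d'" for i j
      using i
    proof (rule less_add_cases)
      assume "i < d"
      then show ?thesis
        using j uv by (elim less_add_cases) (auto simp: juxtapose_def c(3) ne)
    next
      fix i' assume "i = d + i'" "i' < d'"
      then show ?thesis
        using j uv by (elim less_add_cases) (auto simp: juxtapose_def c'(3) ne[symmetric])
    qed
    then show "case e of (u, v) \<Rightarrow> \<forall>i<d + d'. \<forall>j<d + d'.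
        juxtapose d k c c' i u \<noteq> juxtapose d k c c' j v"
      by (simp add: e)
  qed
qed

lemma juxtapose_eq_iff:
  assumes "star H d k c1" "star H d k c2" "u \<in> pverts H"
  shows "j < d \<Longrightarrow> j' < d \<Longrightarrow> juxtapose d k c1 c1' j u = juxtapose d k c2 c2' j' u \<longleftrightarrow> c1 j u = c2 j' u"
    and "juxtapose d k c1 c1' (d + i) u = juxtapose d k c2 c2' (d + i') u \<longleftrightarrow> c1' i u = c2' i' u"
    and "j < d \<Longrightarrow> juxtapose d k c1 c1' j u \<noteq> juxtapose d k c2 c2' (d + i') u"
    and "j' < d \<Longrightarrow> juxtapose d k c1 c1' (d + i) u \<noteq> juxtapose d k c2 c2' j' u"
  using star_less[OF assms(1) _ _ assms(3)] star_less[OF assms(2) _ _ assms(3)]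
  by (force simp: juxtapose_def)+

text \<open>The first block supplies the one shared colour; the unlinked second block adds none, and
  the shift by \<open>k\<close> prevents coincidences across blocks.\<close>

lemma linked_juxtapose1:
  assumes "star H d k c1" "star H d k c2" "linked H d i c1 c2" "unlinked H d' c1' c2'" "i < d"
  shows "linked H (d + d') i (juxtapose d k c1 c1') (juxtapose d k c2 c2')"
  unfolding linked_def
proof (intro ballI allI impI)
  fix u j j' assume "u \<in> pverts H" "j < d + d'" "j' < d + d'"
  then show "juxtapose d k c1 c1' j u = juxtapose d k c2 c2' j' u \<longleftrightarrow> j = i \<and> j' = i"
    using assms(3-5)
    by (elim less_add_cases)
      (simp_all add: juxtapose_eq_iff[OF assms(1,2)] linked_def unlinked_def)
qed

lemma linked_juxtapose2:
  assumes "star H d k c1" "star H d k c2" "unlinked H d c1 c2" "linked H d' i c1' c2'"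
  shows "linked H (d + d') (d + i) (juxtapose d k c1 c1') (juxtapose d k c2 c2')"
  unfolding linked_def
proof (intro ballI allI impI)
  fix u j j' assume "u \<in> pverts H" "j < d + d'" "j' < d + d'"
  then show "juxtapose d k c1 c1' j u = juxtapose d k c2 c2' j' u \<longleftrightarrow> j = d + i \<and> j' = d + i"
    using assms(3,4)
    by (elim less_add_cases)
      (simp_all add: juxtapose_eq_iff[OF assms(1,2)] linked_def unlinked_def)
qed

lemma unlinked_juxtapose:
  assumes "star H d k c1" "star H d k c2" "unlinked H d c1 c2" "unlinked H d' c1' c2'"
  shows "unlinked H (d + d') (juxtapose d k c1 c1') (juxtapose d k c2 c2')"
  unfolding unlinked_def
proof (intro ballI allI impI)
  fix u j j' assume "u \<in> pverts H" "j < d + d'" "j' < d + d'"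
  then show "juxtapose d k c1 c1' j u \<noteq> juxtapose d k c2 c2' j' u"
    using assms(3,4)
    by (elim less_add_cases)
      (simp_all add: juxtapose_eq_iff[OF assms(1,2)] unlinked_def)
qed

text \<open>For an index of one block, the partner takes a linked star in that block and an unlinked
  star in the other.\<close>

lemma star_systems_juxtapose:
  assumes "pair_graph H" "star_system H d k \<Sigma>" "star_system H d' k' \<Sigma>'"
  shows "star_system H (d + d') (k + k') {juxtapose d k c c' | c c'. c \<in> \<Sigma> \<and> c' \<in> \<Sigma>'}"
    (is "star_system _ _ _ ?J")
  unfolding star_system_def
proof (intro conjI ballI)
  show "?J \<noteq> {}"
    using assms(2,3) by (auto simp: star_system_def)
  have mem: "juxtapose d k c c' \<in> ?J" if "c \<in> \<Sigma>" "c' \<in> \<Sigma>'" for c c'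
    using that by blast
  have \<Sigma>: "star H d k c" "\<exists>c'\<in>\<Sigma>. unlinked H d c c'" "i < d \<Longrightarrow> \<exists>c'\<in>\<Sigma>. linked H d i c c'"
    if "c \<in> \<Sigma>" for c i
    using assms(2) that by (auto simp: star_system_def)
  have \<Sigma>': "star H d' k' c" "\<exists>c'\<in>\<Sigma>'. unlinked H d' c c'" "i < d' \<Longrightarrow> \<exists>c'\<in>\<Sigma>'. linked H d' i c c'"
    if "c \<in> \<Sigma>'" for c i
    using assms(3) that by (auto simp: star_system_def)
  fix x assume "x \<in> ?J"
  then obtain c c' where x: "x = juxtapose d k c c'" and c: "c \<in> \<Sigma>" and c': "c' \<in> \<Sigma>'"
    by blast
  show "star H (d + d') (k + k') x"
    unfolding x using assms(1) \<Sigma>(1)[OF c] \<Sigma>'(1)[OF c'] by (rule star_juxtapose)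
  obtain e e' where e: "e \<in> \<Sigma>" "unlinked H d c e" and e': "e' \<in> \<Sigma>'" "unlinked H d' c' e'"
    using \<Sigma>(2)[OF c] \<Sigma>'(2)[OF c'] by blast
  show "\<exists>y\<in>?J. unlinked H (d + d') x y"
    using unlinked_juxtapose[OF \<Sigma>(1)[OF c] \<Sigma>(1)[OF e(1)] e(2) e'(2)] mem[OF e(1) e'(1)]
    unfolding x by (rule bexI)
  show "\<forall>i<d + d'. \<exists>y\<in>?J. linked H (d + d') i x y"
  proof (intro allI impI)
    fix i assume "i < d + d'"
    then show "\<exists>y\<in>?J. linked H (d + d') i x y"
    proof (cases rule: less_add_cases)
      case 1
      then obtain c2 where c2: "c2 \<in> \<Sigma>" "linked H d i c c2"
        using \<Sigma>(3)[OF c] by blast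
      show ?thesis
        using linked_juxtapose1[OF \<Sigma>(1)[OF c] \<Sigma>(1)[OF c2(1)] c2(2) e'(2) 1] mem[OF c2(1) e'(1)]
        unfolding x by (rule bexI)
    next
      case (2 i')
      then obtain c2 where c2: "c2 \<in> \<Sigma>'" "linked H d' i' c' c2"
        using \<Sigma>'(3)[OF c'] by blast
      show ?thesis
        using linked_juxtapose2[OF \<Sigma>(1)[OF c] \<Sigma>(1)[OF e(1)] e(2) c2(2)] mem[OF e(1) c2(1)]
        unfolding x 2(1) by (rule bexI)
    qed
  qed
qed

section \<open>Transport of star systems along homomorphisms\<close>

text \<open>Every condition concerns a single layer or two adjacent layers, and \<open>h\<close>
  preserves both situations.\<close>

lemma star_system_pullback:
  assumes h: "graph_hom H H' h" and \<Sigma>: "star_system H' d k \<Sigma>"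
  shows "star_system H d k ((\<lambda>c i u. c i (h u)) ` \<Sigma>)"
proof -
  have h1: "h u \<in> pverts H'" if "u \<in> pverts H" for u
    using h that by (auto simp: graph_hom_def)
  have h2: "(h u, h v) \<in> parcs H'" if "(u, v) \<in> parcs H" for u v
    using h that by (auto simp: graph_hom_def)
  show ?thesis
    unfolding star_system_def
  proof (intro conjI ballI; (elim imageE)?)
    show "(\<lambda>c i u. c i (h u)) ` \<Sigma> \<noteq> {}"
      using \<Sigma> by (simp add: star_system_def)
    fix c' c assume c': "c' = (\<lambda>i u. c i (h u))" and c: "c \<in> \<Sigma>"
    show "star H d k c'"
    proof -
      have "star H' d k c"
        using \<Sigma> c by (simp add: star_system_def)
      from starD[OF this] show ?thesis
        unfolding c' star_def by (auto simp: h1 dest: h2)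
    qed
    obtain e where "e \<in> \<Sigma>" "unlinked H' d c e"
      using \<Sigma> c unfolding star_system_def by blast
    then show "\<exists>c''\<in>(\<lambda>c i u. c i (h u)) ` \<Sigma>. unlinked H d c' c''"
      unfolding c' unlinked_def by (intro bexI[of _ "\<lambda>i u. e i (h u)"]) (auto simp: h1)
    show "\<forall>i<d. \<exists>c''\<in>(\<lambda>c i u. c i (h u)) ` \<Sigma>. linked H d i c' c''"
    proof (intro allI impI)
      fix i assume "i < d"
      then obtain c'' where "c'' \<in> \<Sigma>" "linked H' d i c c''"
        using \<Sigma> c unfolding star_system_def by blast
      then show "\<exists>c''\<in>(\<lambda>c i u. c i (h u)) ` \<Sigma>. linked H d i c' c''"
        unfolding c' linked_def by (intro bexI[of _ "\<lambda>i u. c'' i (h u)"]) (auto simp: h1)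
    qed
  qed
qed

text \<open>Injective recolourings and endomorphisms of \<open>H\<close> preserve stars and links,
  so it suffices to find the partners of \<open>q\<close>: applying \<rho> and \<alpha> to a partner
  of \<open>q\<close> gives a partner of the image of \<open>q\<close> under \<rho> and
  \<alpha>.\<close>

lemma star_system_orbit:
  assumes H: "pair_graph H" and q: "star H d k q"
    and \<sigma>: "graph_hom H H \<sigma>" "\<And>u. u \<in> pverts H \<Longrightarrow> (u, \<sigma> u) \<in> parcs H"
    and links: "\<And>i. i < d \<Longrightarrow> \<exists>\<rho> \<alpha>. inj_on \<rho> {..<k} \<and> \<rho> ` {..<k} \<subseteq> {..<k} \<and>
      graph_hom H H \<alpha> \<and> linked H d i q (\<lambda>j u. \<rho> (q j (\<alpha> u)))"
  shows "star_system H d k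
    {\<lambda>i u. \<rho> (q i (\<alpha> u)) | \<rho> \<alpha>. inj_on \<rho> {..<k} \<and> \<rho> ` {..<k} \<subseteq> {..<k} \<and> graph_hom H H \<alpha>}"
    (is "star_system H d k ?\<Sigma>")
  unfolding star_system_def
proof (intro conjI ballI)
  interpret pair_graph H by fact
  have "q \<in> ?\<Sigma>"
    by (intro CollectI exI[of _ "\<lambda>x. x"]) (auto simp: graph_hom_def)
  then show "?\<Sigma> \<noteq> {}" by blast
  have qk: "q i u < k" if "u \<in> pverts H" "i < d" for i u
    using q that by (simp add: star_def)
  have mem: "(\<lambda>i u. \<rho> (\<rho>' (q i (\<alpha>' (\<alpha> u))))) \<in> ?\<Sigma>"
    if "inj_on \<rho> {..<k}" "\<rho> ` {..<k} \<subseteq> {..<k}" "graph_hom H H \<alpha>"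
      "inj_on \<rho>' {..<k}" "\<rho>' ` {..<k} \<subseteq> {..<k}" "graph_hom H H \<alpha>'" for \<rho> \<rho>' \<alpha> \<alpha>'
    using that
  proof (intro CollectI exI[of _ "\<rho> \<circ> \<rho>'"] exI[of _ "\<alpha>' \<circ> \<alpha>"] conjI)
    show "inj_on (\<rho> \<circ> \<rho>') {..<k}"
      using that by (blast intro: comp_inj_on inj_on_subset)
    show "(\<rho> \<circ> \<rho>') ` {..<k} \<subseteq> {..<k}"
      using that by (auto simp: image_subset_iff)
    show "graph_hom H H (\<alpha>' \<circ> \<alpha>)"
      using that by (auto simp: graph_hom_def image_subset_iff)
  qed simp
  fix c assume "c \<in> ?\<Sigma>"
  then obtain \<rho> \<alpha> where c: "c = (\<lambda>i u. \<rho> (q i (\<alpha> u)))"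
    and \<rho>: "inj_on \<rho> {..<k}" "\<rho> ` {..<k} \<subseteq> {..<k}" and \<alpha>: "graph_hom H H \<alpha>"
    by auto
  have \<rho>_eq: "\<rho> x = \<rho> y \<longleftrightarrow> x = y" if "x < k" "y < k" for x y
    using \<rho>(1) that by (auto dest: inj_onD)
  have \<rho>_less: "\<rho> x < k" if "x < k" for x
    using \<rho>(2) that by auto
  have \<alpha>1: "\<alpha> u \<in> pverts H" if "u \<in> pverts H" for u
    using \<alpha> that by (auto simp: graph_hom_def)
  have \<alpha>2: "(\<alpha> u, \<alpha> v) \<in> parcs H" if "(u, v) \<in> parcs H" for u v
    using \<alpha> that by (auto simp: graph_hom_def)
  have verts: "u \<in> pverts H" "v \<in> pverts H" if "(u, v) \<in> parcs H" for u v
    using wellformed[OF that] by auto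
  show "star H d k c"
    unfolding star_def c
    using starD[OF q] by (auto simp: \<rho>_eq \<rho>_less qk \<alpha>1 verts \<alpha>2)
  \<comment> \<open>Moving along \<sigma> compares each layer with an adjacent one, where the
    colours of a star are disjoint from its own.\<close>
  show "\<exists>c'\<in>?\<Sigma>. unlinked H d c c'"
  proof
    show "(\<lambda>i u. \<rho> (q i (\<sigma> (\<alpha> u)))) \<in> ?\<Sigma>"
      using mem[of \<rho> \<alpha> "\<lambda>x. x" \<sigma>] \<rho> \<alpha> \<sigma> by simp
    show "unlinked H d c (\<lambda>i u. \<rho> (q i (\<sigma> (\<alpha> u))))"
      unfolding unlinked_def c
      using star_adj[OF q] \<sigma>(2)[OF \<alpha>1] by (auto simp: \<rho>_eq qk \<alpha>1 verts(2)[OF \<sigma>(2)])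
  qed
  show "\<forall>i<d. \<exists>c'\<in>?\<Sigma>. linked H d i c c'"
  proof (intro allI impI)
    fix i assume "i < d"
    then obtain \<rho>' \<alpha>' where \<rho>': "inj_on \<rho>' {..<k}" "\<rho>' ` {..<k} \<subseteq> {..<k}" and \<alpha>': "graph_hom H H \<alpha>'"
      and l: "linked H d i q (\<lambda>j u. \<rho>' (q j (\<alpha>' u)))"
      using links by blast
    have less: "\<rho>' (q j (\<alpha>' u)) < k" if "u \<in> pverts H" "j < d" for j u
    proof -
      have "\<alpha>' u \<in> pverts H"
        using \<alpha>' that by (auto simp: graph_hom_def)
      then show ?thesis
        using \<rho>'(2) that qk by (simp add: image_subset_iff)
    qed
    show "\<exists>c'\<in>?\<Sigma>. linked H d i c c'"
    proof
      show "(\<lambda>i u. \<rho> (\<rho>' (q i (\<alpha>' (\<alpha> u))))) \<in> ?\<Sigma>"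
        using mem \<rho> \<rho>' \<alpha> \<alpha>' by blast
      show "linked H d i c (\<lambda>i u. \<rho> (\<rho>' (q i (\<alpha>' (\<alpha> u)))))"
        using l unfolding linked_def c by (auto simp: \<rho>_eq less qk \<alpha>1)
    qed
  qed
qed

section \<open>Homomorphisms between cycles and star systems on odd cycles\<close>

text \<open>The target is symmetric, so the forward arcs of the cycle are enough.\<close>

lemma graph_hom_cycleI:
  assumes n: "3 \<le> n" and H: "pair_graph H" and h: "\<And>u. u < n \<Longrightarrow> (h u, h (Suc u mod n)) \<in> parcs H"
  shows "graph_hom (cycle_graph n) H h"
proof -
  interpret pair_graph H by fact
  have "(h v, h u) \<in> parcs H" if "(h u, h v) \<in> parcs H" for u v
    using that sym_arcs by (auto simp: symmetric_def sym_def)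
  moreover have "h u \<in> pverts H" if "u < n" for u
    using wellformed[OF h[OF that]] by simp
  ultimately show ?thesis
    using h by (auto simp: graph_hom_def cycle_graph_def)
qed

text \<open>This is the reflection \<open>s - u\<close> modulo \<open>n\<close>; adding
  \<open>n\<close> first keeps the subtraction of natural numbers from being truncated.\<close>

lemma graph_hom_reflection:
  assumes n: "3 \<le> n"
  shows "graph_hom (cycle_graph n) (cycle_graph n) (\<lambda>u. (s + n - u) mod n)"
proof (rule graph_hom_cycleI[OF n pair_graph_cycle_graph[OF n]])
  fix u assume u: "u < n"
  show "((s + n - u) mod n, (s + n - Suc u mod n) mod n) \<in> parcs (cycle_graph n)"
  proof (cases "Suc u = n")
    case True
    then have "s + n - u = Suc s" by auto
    then show ?thesis
      using n True by (auto simp: cycle_graph_def mod_simps)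
  next
    case False
    with u have "s + n - u = Suc (s + n - Suc u)" "Suc u mod n = Suc u" by auto
    then show ?thesis
      using n by (auto simp: cycle_graph_def mod_simps)
  qed
qed

lemma graph_hom_rotation:
  assumes n: "3 \<le> n"
  shows "graph_hom (cycle_graph n) (cycle_graph n) (\<lambda>u. Suc u mod n)"
  by (rule graph_hom_cycleI[OF n pair_graph_cycle_graph[OF n]]) (use n in \<open>auto simp: cycle_graph_def\<close>)

text \<open>The long cycle runs once along the short one and then back and forth on the edge between
  \<open>2 * g\<close> and \<open>0\<close>. The number of extra layers is even, so the walk ends at
  \<open>2 * g\<close> and closes up.\<close>

lemma graph_hom_fold:
  assumes "1 \<le> g" "g \<le> l"
  shows "graph_hom (cycle_graph (2 * l + 1)) (cycle_graph (2 * g + 1))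
    (\<lambda>u. if u \<le> 2 * g then u else if odd u then 0 else 2 * g)"
proof (rule graph_hom_cycleI)
  let ?h = "\<lambda>u :: nat. if u \<le> 2 * g then u else if odd u then 0 else 2 * g"
  fix u assume u: "u < 2 * l + 1"
  consider "u < 2 * g" | "u = 2 * g" "g < l" | "u = 2 * g" "g = l" | "2 * g < u" "u < 2 * l" "odd u"
    | "2 * g < u" "u < 2 * l" "even u" | "2 * g < u" "u = 2 * l"
    using u assms by linarith
  then show "(?h u, ?h (Suc u mod (2 * l + 1))) \<in> parcs (cycle_graph (2 * g + 1))"
    by cases (use assms in \<open>auto simp: cycle_graph_def\<close>)
next
  show "3 \<le> 2 * l + 1" "pair_graph (cycle_graph (2 * g + 1))"
    using assms by (auto intro: pair_graph_cycle_graph)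
qed

text \<open>
  The star is \<open>q\<close>; its partner for the index \<open>i\<close> is obtained from the reflection \<open>u \<mapsto> s\<^sub>i - u\<close> of the
  layers and the permutation \<open>r\<^sub>i\<close> of the colours.
\<close>

lemma star_system_cycleI:
  assumes n: "3 \<le> n"
    and q: "\<forall>u<n. \<forall>i<d. \<forall>j<d. q ! i ! u < k \<and> (q ! i ! u = q ! j ! u \<longrightarrow> i = j) \<and>
      q ! i ! u \<noteq> q ! j ! (Suc u mod n)"
    and r: "\<forall>i<d. distinct (r ! i) \<and> length (r ! i) = k \<and> (\<forall>x\<in>set (r ! i). x < k) \<and>
      (\<forall>u<n. \<forall>j<d. \<forall>j'<d. q ! j ! u = r ! i ! (q ! j' ! ((s ! i + n - u) mod n)) \<longleftrightarrow> j = i \<and> j' = i)"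
  shows "\<exists>\<Sigma>. star_system (cycle_graph n) d k \<Sigma>"
proof (rule exI, rule star_system_orbit)
  show "pair_graph (cycle_graph n)"
    by (rule pair_graph_cycle_graph[OF n])
  \<comment> \<open>The hypothesis compares a layer with its successor only, but for all pairs of
    indices, which covers both directions of an arc.\<close>
  show "star (cycle_graph n) d k (\<lambda>i u. q ! i ! u)"
    using q by (fastforce simp: star_def cycle_graph_def)
  show "graph_hom (cycle_graph n) (cycle_graph n) (\<lambda>u. Suc u mod n)"
    by (rule graph_hom_rotation[OF n])
  show "(u, Suc u mod n) \<in> parcs (cycle_graph n)" if "u \<in> pverts (cycle_graph n)" for u
    using that n by (auto simp: cycle_graph_def)
  fix i assume i: "i < d"
  show "\<exists>\<rho> \<alpha>. inj_on \<rho> {..<k} \<and> \<rho> ` {..<k} \<subseteq> {..<k} \<and> graph_hom (cycle_graph n) (cycle_graph n) \<alpha> \<and>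
      linked (cycle_graph n) d i (\<lambda>i u. q ! i ! u) (\<lambda>j u. \<rho> (q ! j ! \<alpha> u))"
  proof (intro exI conjI)
    show "inj_on ((!) (r ! i)) {..<k}" "(!) (r ! i) ` {..<k} \<subseteq> {..<k}"
      using r i by (auto intro: inj_on_nth)
    show "graph_hom (cycle_graph n) (cycle_graph n) (\<lambda>u. (s ! i + n - u) mod n)"
      by (rule graph_hom_reflection[OF n])
    show "linked (cycle_graph n) d i (\<lambda>i u. q ! i ! u) (\<lambda>j u. r ! i ! (q ! j ! ((s ! i + n - u) mod n)))"
      using r i by (auto simp: linked_def cycle_graph_def)
  qed
qed

text \<open>With one index, linked stars agree in every layer. The star is its own partner: the
  permutation is negation modulo 3 and undoes the reflection.\<close>

lemma star_system_cycle3: "\<exists>\<Sigma>. star_system (cycle_graph 3) 1 3 \<Sigma>"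
  by (rule star_system_cycleI[where q = "[[0, 1, 2]]" and r = "[[0, 2, 1]]" and s = "[0]"]; code_simp)

text \<open>Modulo 5, layer \<open>u\<close> has the colours \<open>u\<close> and
  \<open>u + 3\<close>. The permutations \<open>-x\<close> and \<open>1 - x\<close> turn the
  reflected star into the partners with colours \<open>u\<close>, \<open>u + 2\<close> and
  \<open>u + 1\<close>, \<open>u + 3\<close>.\<close>

lemma star_system_cycle5: "\<exists>\<Sigma>. star_system (cycle_graph 5) 2 5 \<Sigma>"
  by (rule star_system_cycleI[where q = "[[0, 1, 2, 3, 4], [3, 4, 0, 1, 2]]"
        and r = "[[0, 4, 3, 2, 1], [1, 0, 4, 3, 2]]" and s = "[0, 0]"]; code_simp)

text \<open>
  Every colour occupies a maximum independent set of layers, which leaves few candidates; this star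
  and its symmetries were found by a computer search.
\<close>

lemma star_system_cycle7: "\<exists>\<Sigma>. star_system (cycle_graph 7) 3 7 \<Sigma>"
  by (rule star_system_cycleI[
        where q = "[[0, 1, 0, 1, 0, 1, 6], [3, 6, 2, 6, 2, 3, 2], [5, 4, 5, 3, 4, 5, 4]]"
        and r = "[[1, 0, 5, 4, 3, 2, 6], [5, 4, 2, 6, 1, 0, 3], [1, 0, 6, 3, 5, 4, 2]]"
        and s = "[5, 1, 6]"]; code_simp)

text \<open>The quotient is the number of groups. Groups of size \<open>l\<close> are split off one
  by one until at most \<open>l\<close> indices remain; each nonempty group costs one colour more
  than twice its size.\<close>

lemma star_system_odd_cycle:
  assumes l: "l \<in> {1, 2, 3}"
  shows "\<exists>\<Sigma>. star_system (cycle_graph (2 * l + 1)) d (2 * d + (d + l - 1) div l) \<Sigma>"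
proof (induction d rule: less_induct)
  case (less d)
  have graph: "pair_graph (cycle_graph (2 * l + 1))"
    using l by (intro pair_graph_cycle_graph) auto
  have small: "\<exists>\<Sigma>. star_system (cycle_graph (2 * l + 1)) g (2 * g + 1) \<Sigma>" if g: "1 \<le> g" "g \<le> l" for g
  proof -
    have "g \<in> {1, 2, 3}"
      using g l by auto
    then have "\<exists>\<Sigma>. star_system (cycle_graph (2 * g + 1)) g (2 * g + 1) \<Sigma>"
      using star_system_cycle3 star_system_cycle5 star_system_cycle7 by auto
    then show ?thesis
      using star_system_pullback[OF graph_hom_fold[OF g]] by blast
  qed
  consider "d = 0" | "1 \<le> d" "d \<le> l" | "l < d"
    by linarith
  then show ?case
  proof cases
    case 1
    then show ?thesis
      using l star_system_empty by (intro exI[of _ UNIV]) auto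
  next
    case 2
    then have "(d + l - 1) div l = 1"
      using l by (intro div_nat_eqI) auto
    then show ?thesis
      using small[OF 2] by simp
  next
    case 3
    then obtain \<Sigma> where \<Sigma>: "star_system (cycle_graph (2 * l + 1)) (d - l) (2 * (d - l) + (d - l + l - 1) div l) \<Sigma>"
      using less[of "d - l"] l by auto
    obtain \<Sigma>' where \<Sigma>': "star_system (cycle_graph (2 * l + 1)) l (2 * l + 1) \<Sigma>'"
      using small[of l] l by auto
    \<comment> \<open>Splitting off \<open>l\<close> indices lowers the number of groups by exactly
      one.\<close>
    have "d + l - 1 = (d - l + l - 1) + l"
      using 3 l by auto
    then have "(d + l - 1) div l = (d - l + l - 1) div l + 1"
      using l by (metis div_add_self2 insertE singletonD zero_neq_one zero_neq_numeral)
    then have "2 * (d - l) + (d - l + l - 1) div l + (2 * l + 1) = 2 * d + (d + l - 1) div l"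
      using 3 by simp
    then show ?thesis
      using star_systems_juxtapose[OF graph \<Sigma> \<Sigma>'] 3 by (auto simp: less_imp_le)
  qed
qed

text \<open>Position \<open>i\<close> of a table is the colour of the cycle edge from \<open>i\<close> to \<open>i + 1\<close>.\<close>

section \<open>Colouring the fibres\<close>

lemma fibre_coloring_cycleI:
  fixes t :: "bool \<Rightarrow> nat list"
  assumes n: "3 \<le> n"
    and "\<forall>i<n. t False ! i \<noteq> t False ! (Suc i mod n) \<and> t False ! i \<noteq> t False ! (Suc (Suc i) mod n)"
    and "\<forall>i<n. t True ! i \<noteq> t True ! (Suc i mod n) \<and> t True ! i \<noteq> t True ! (Suc (Suc i) mod n)"
    and "\<forall>i<n. t True ! i \<noteq> t False ! i \<and> t True ! i \<noteq> t False ! (Suc i mod n) \<and>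
      t True ! (Suc i mod n) \<noteq> t False ! i"
    and k: "\<forall>i<n. t False ! i < k \<and> t True ! i < k"
  obtains h :: "bool \<Rightarrow> nat \<Rightarrow> nat \<Rightarrow> nat" where
    "\<And>b u v. (u, v) \<in> parcs (cycle_graph n) \<Longrightarrow> h b u v < k"
    "\<And>b u v. (u, v) \<in> parcs (cycle_graph n) \<Longrightarrow> h b u v = h b v u"
    "\<And>b u v u' v'. (u, v) \<in> parcs (cycle_graph n) \<Longrightarrow> (u', v') \<in> parcs (cycle_graph n) \<Longrightarrow>
       u = u' \<or> (u, u') \<in> parcs (cycle_graph n) \<Longrightarrow> h b u v = h b u' v' \<Longrightarrow> {u, v} = {u', v'}"
    "\<And>b u v v'. (u, v) \<in> parcs (cycle_graph n) \<Longrightarrow> (u, v') \<in> parcs (cycle_graph n) \<Longrightarrow>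
       h b u v \<noteq> h (\<not> b) u v'"
proof -
  define S where "S i = Suc i mod n" for i
  have S_less: "S i < n" for i
    using n by (simp add: S_def)
  have S_inj: "S i = S j \<longleftrightarrow> i = j" if "i < n" "j < n" for i j
    using that by (auto simp: S_def mod_Suc split: if_splits)
  \<comment> \<open>Since \<open>n\<close> is at least 3, the two ends of an edge are not each the
    successor of the other, so the table position of an edge is well defined.\<close>
  have SS: "S (S i) \<noteq> i" if "i < n" for i
    using that n by (auto simp: S_def mod_Suc split: if_splits)
  have t: "t b ! i \<noteq> t b ! S i" "t b ! i \<noteq> t b ! S (S i)" if "i < n" for b i
    using assms(2,3) that by (cases b; simp add: S_def mod_simps)+
  have t': "t b ! i \<noteq> t (\<not> b) ! i" "t b ! i \<noteq> t (\<not> b) ! S i" "t b ! S i \<noteq> t (\<not> b) ! i" if "i < n" for b i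
    using assms(4) that by (cases b; force simp add: S_def)+
  define h where "h b u v = t b ! (if v = S u then u else v)" for b u v
  have arc: "(u, v) \<in> parcs (cycle_graph n) \<longleftrightarrow> u < n \<and> v < n \<and> (v = S u \<or> u = S v)" for u v
    by (auto simp: cycle_graph_def S_def)
  have idx: "\<exists>i<n. (\<forall>b. h b u v = t b ! i) \<and> {u, v} = {i, S i} \<and> u \<in> {i, S i}"
    if "(u, v) \<in> parcs (cycle_graph n)" for u v
    using that SS by (auto simp: arc h_def)
  \<comment> \<open>Edges with a common vertex have equal or cyclically consecutive
    positions.\<close>
  have near: "i = i' \<or> i' = S i \<or> i = S i'"
    if "u \<in> {i, S i}" "u \<in> {i', S i'}" "i < n" "i' < n" for u i i'
    using that S_inj by auto
  have "t b ! i < k" if "i < n" for b i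
    using k that by (cases b) auto
  then have "h b u v < k" if "(u, v) \<in> parcs (cycle_graph n)" for b u v
    using idx[OF that] by auto
  moreover have "h b u v = h b v u" if "(u, v) \<in> parcs (cycle_graph n)" for b u v
    using that SS[of u] SS[of v] unfolding arc h_def by presburger
  moreover have "{u, v} = {u', v'}"
    if uv: "(u, v) \<in> parcs (cycle_graph n)" and uv': "(u', v') \<in> parcs (cycle_graph n)"
      and adj: "u = u' \<or> (u, u') \<in> parcs (cycle_graph n)" and eq: "h b u v = h b u' v'" for b u v u' v'
  proof -
    obtain i where i: "i < n" "h b u v = t b ! i" "{u, v} = {i, S i}" "u \<in> {i, S i}"
      using idx[OF uv] by blast
    obtain i' where i': "i' < n" "h b u' v' = t b ! i'" "{u', v'} = {i', S i'}" "u' \<in> {i', S i'}"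
      using idx[OF uv'] by blast
    \<comment> \<open>Edges that meet or are joined by an edge have positions at cyclic distance at
      most two, which is the range in which a table has no repetition.\<close>
    have "i = i' \<or> i' = S i \<or> i = S i' \<or> i' = S (S i) \<or> i = S (S i')"
      using adj
    proof
      assume "u = u'"
      then show ?thesis using near i(1,4) i'(1,4) by blast
    next
      assume "(u, u') \<in> parcs (cycle_graph n)"
      then have "u' = S u \<or> u = S u'" by (simp add: arc)
      then show ?thesis
        using i(1,4) i'(1,4) S_inj[OF i(1) S_less] S_inj[OF S_less i'(1)] S_inj[OF i(1) i'(1)]
          S_inj[OF i'(1) S_less] S_inj[OF S_less i(1)] S_inj[OF S_less S_less] by auto
    qed
    then have "i = i'"
      using eq i(1,2) i'(1,2) t[of i b] t[of i' b] by auto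
    then show ?thesis
      using i(3) i'(3) by simp
  qed
  moreover have "h b u v \<noteq> h (\<not> b) u v'"
    if uv: "(u, v) \<in> parcs (cycle_graph n)" and uv': "(u, v') \<in> parcs (cycle_graph n)" for b u v v'
  proof -
    obtain i where i: "i < n" "h b u v = t b ! i" "u \<in> {i, S i}"
      using idx[OF uv] by blast
    obtain i' where i': "i' < n" "h (\<not> b) u v' = t (\<not> b) ! i'" "u \<in> {i', S i'}"
      using idx[OF uv'] by blast
    show ?thesis
      using near[OF i(3) i'(3) i(1) i'(1)] i(1,2) i'(1,2) t'[of i b] t'[of i' b] by auto
  qed
  ultimately show ?thesis
    by (rule that)
qed

lemma fibre_coloring_short_odd_cycle:
  assumes "n \<in> {3, 5, 7}"
  obtains h :: "bool \<Rightarrow> nat \<Rightarrow> nat \<Rightarrow> nat" where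
    "\<And>b u v. (u, v) \<in> parcs (cycle_graph n) \<Longrightarrow> h b u v < 6"
    "\<And>b u v. (u, v) \<in> parcs (cycle_graph n) \<Longrightarrow> h b u v = h b v u"
    "\<And>b u v u' v'. (u, v) \<in> parcs (cycle_graph n) \<Longrightarrow> (u', v') \<in> parcs (cycle_graph n) \<Longrightarrow>
       u = u' \<or> (u, u') \<in> parcs (cycle_graph n) \<Longrightarrow> h b u v = h b u' v' \<Longrightarrow> {u, v} = {u', v'}"
    "\<And>b u v v'. (u, v) \<in> parcs (cycle_graph n) \<Longrightarrow> (u, v') \<in> parcs (cycle_graph n) \<Longrightarrow>
       h b u v \<noteq> h (\<not> b) u v'"
proof -
  consider "n = 3" | "n = 5" | "n = 7"
    using assms by blast
  then show ?thesis
  proof cases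
    case 1
    show ?thesis
      by (rule fibre_coloring_cycleI[of 3 "\<lambda>b. if b then [3, 4, 5] else [0, 1, 2]" 6, rotated -1],
          rule that[unfolded 1], assumption+; code_simp)
  next
    case 2
    \<comment> \<open>The second table is the first one rotated by two positions, that is,
      \<open>i + 2\<close> modulo 5 against \<open>i\<close>.\<close>
    show ?thesis
      by (rule fibre_coloring_cycleI[of 5 "\<lambda>b. if b then [2, 3, 4, 0, 1] else [0, 1, 2, 3, 4]" 6,
            rotated -1],
          rule that[unfolded 2], assumption+; code_simp)
  next
    case 3
    \<comment> \<open>A colour class of a strong edge colouring has at most two of the seven edges,
      so each table needs four colours. The tables share 2 and 3, placed at positions that are
      neither equal nor consecutive.\<close>
    show ?thesis
      by (rule fibre_coloring_cycleI[of 7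
            "\<lambda>b. if b then [2, 3, 4, 5, 3, 4, 5] else [0, 1, 2, 0, 1, 2, 3]" 6, rotated -1],
          rule that[unfolded 3], assumption+; code_simp)
  qed
qed

section \<open>The product of a tree and a cycle\<close>

text \<open>Being strong means that distinct edges which meet or are joined by an edge get different
  colours. Stated on arcs, \<open>sep\<close> only has to compare first endpoints, because every
  edge appears with both orientations.\<close>

lemma strong_chromatic_index_le:
  assumes "pair_graph G"
    and sym: "\<And>x y. (x, y) \<in> parcs G \<Longrightarrow> \<phi> x y = \<phi> y x"
    and bound: "\<And>x y. (x, y) \<in> parcs G \<Longrightarrow> \<phi> x y < k"
    and sep: "\<And>x y x' y'. (x, y) \<in> parcs G \<Longrightarrow> (x', y') \<in> parcs G \<Longrightarrow>
      x = x' \<or> (x, x') \<in> parcs G \<Longrightarrow> \<phi> x y = \<phi> x' y' \<Longrightarrow> {x, y} = {x', y'}"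
  shows "strong_chromatic_index G \<le> k"
proof -
  interpret pair_graph G by fact
  define f where "f e = (SOME c. \<exists>x y. (x, y) \<in> parcs G \<and> e = {x, y} \<and> c = \<phi> x y)" for e
  have arc_sym: "(y, x) \<in> parcs G" if "(x, y) \<in> parcs G" for x y
    using that sym_arcs by (auto simp: symmetric_def sym_def)
  have f: "f {x, y} = \<phi> x y" if "(x, y) \<in> parcs G" for x y
    unfolding f_def using that sym by (intro some_equality) (auto simp: doubleton_eq_iff)
  have edgeE: "\<exists>y. e = {x, y} \<and> (x, y) \<in> parcs G" if "e \<in> uedges G" "x \<in> e" for e x
    using that arc_sym by (auto simp: uedges_def)
  have proper: "e = e'" if "e \<in> uedges G" "e' \<in> uedges G" "x \<in> e" "x \<in> e'" "f e = f e'" for e e' x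
    using edgeE[OF that(1,3)] edgeE[OF that(2,4)] that(5) sep f by metis
  have induced: "e \<in> {e \<in> uedges G. f e = c}"
    if e: "e \<in> uedges G" "e \<subseteq> \<Union>{e \<in> uedges G. f e = c}" for e c
  proof -
    obtain x y where xy: "e = {x, y}" "(x, y) \<in> parcs G"
      using e by (auto simp: uedges_def)
    \<comment> \<open>The edges of colour \<open>c\<close> at \<open>x\<close> and at
      \<open>y\<close> are joined by \<open>e\<close>, hence coincide, and the common edge has both
      ends of \<open>e\<close>.\<close>
    obtain e1 e2 where 1: "e1 \<in> uedges G" "x \<in> e1" "f e1 = c" and 2: "e2 \<in> uedges G" "y \<in> e2" "f e2 = c"
      using e(2) xy(1) by auto
    obtain x' y' where x': "e1 = {x, x'}" "(x, x') \<in> parcs G" and y': "e2 = {y, y'}" "(y, y') \<in> parcs G"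
      using edgeE 1 2 by metis
    have "e1 = e2"
      using sep[OF x'(2) y'(2)] xy 1 2 x' y' f by simp
    moreover have "x \<noteq> y"
      using pair_no_loops xy(2) by fastforce
    ultimately have "e = e1"
      using x' y' xy by (auto simp: doubleton_eq_iff)
    then show ?thesis using 1 by simp
  qed
  have "matching G {e \<in> uedges G. f e = c}" for c
    using proper unfolding matching_def by blast
  moreover have "{e \<in> uedges G. e \<subseteq> \<Union>{e \<in> uedges G. f e = c}} = {e \<in> uedges G. f e = c}" for c
    using induced by blast
  moreover have "proper_edge_coloring G f"
    using proper unfolding proper_edge_coloring_def by blast
  ultimately have "strong_edge_coloring G f"
    by (simp add: strong_edge_coloring_def induced_matching_def)
  moreover have "f ` uedges G \<subseteq> {..<k}"
    using f bound by (auto simp: uedges_def)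
  ultimately show ?thesis
    unfolding strong_chromatic_index_def by (intro Least_le) blast
qed

lemma cartesian_product_arc_cases:
  assumes "(x, y) \<in> parcs (G \<box> H)"
  obtains (fst) a b u where "x = (a, u)" "y = (b, u)" "(a, b) \<in> parcs G" "u \<in> pverts H"
    | (snd) a u v where "x = (a, u)" "y = (a, v)" "(u, v) \<in> parcs H" "a \<in> pverts G"
proof -
  obtain a u b v where xy: "x = (a, u)" "y = (b, v)"
    by (cases x; cases y) blast
  with assms consider "u = v" "(a, b) \<in> parcs G" "u \<in> pverts H" | "a = b" "(u, v) \<in> parcs H" "a \<in> pverts G"
    by (auto simp: cartesian_product_def)
  then show ?thesis
    using fst[of a u b] snd[of a u v] xy by cases simp_all
qed

lemma ceiling_divide_nat:
  assumes "0 < l"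
  shows "\<lceil>real d / real l\<rceil> = int ((d + l - 1) div l)"
proof (rule ceiling_unique)
  let ?q = "(d + l - 1) div l"
  have "?q * l \<le> d + l - 1" "d + l - 1 < ?q * l + l"
    using div_times_less_eq_dividend[of "d + l - 1" l] dividend_less_div_times[OF assms, of "d + l - 1"]
    by linarith+
  then have "?q * l < d + l" "d \<le> ?q * l"
    using assms by linarith+
  then have "real ?q * real l < real d + real l" "real d \<le> real ?q * real l"
    by (simp_all flip: of_nat_mult of_nat_add)
  then show "of_int (int ?q) - 1 < real d / real l" "real d / real l \<le> of_int (int ?q)"
    using assms by (simp_all add: field_simps)
qed

theorem theorem13:
  fixes T :: "'a pair_pre_digraph" and l :: nat
  assumes "undirected_tree T"
    and "l \<in> {1, 2, 3}"
  shows "int (strong_chromatic_index (T \<box> cycle_graph (2 * l + 1)))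
           \<le> 2 * int (max_degree T) + \<lceil>real (max_degree T) / real l\<rceil> + 6"
proof -
  define C where "C = cycle_graph (2 * l + 1)"
  define d where "d = max_degree T"
  define k where "k = 2 * d + (d + l - 1) div l"
  interpret T: pair_graph T using assms(1) by (simp add: undirected_tree_def)
  have C: "pair_graph C"
    unfolding C_def using assms(2) by (intro pair_graph_cycle_graph) auto
  interpret C: pair_graph C by (rule C)
  have C_loop: "(u, u) \<notin> parcs C" for u
    using C.pair_no_loops by fastforce
  have T_verts: "a \<in> pverts T" if "(a, b) \<in> parcs T" for a b
    using T.wellformed[OF that] by simp
  have arc_sym: "(b, a) \<in> parcs T" if "(a, b) \<in> parcs T" for a b
    using that T.sym_arcs by (auto simp: symmetric_def sym_def)
  obtain \<Sigma> where \<Sigma>: "star_system C d k \<Sigma>"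
    using star_system_odd_cycle[OF assms(2)] unfolding C_def k_def by blast
  have "2 * l + 1 \<in> {3, 5, 7}"
    using assms(2) by auto
  then obtain h :: "bool \<Rightarrow> nat \<Rightarrow> nat \<Rightarrow> nat" where
    h_less: "\<And>b u v. (u, v) \<in> parcs C \<Longrightarrow> h b u v < 6" and
    h_sym: "\<And>b u v. (u, v) \<in> parcs C \<Longrightarrow> h b u v = h b v u" and
    h_strong: "\<And>b u v u' v'. (u, v) \<in> parcs C \<Longrightarrow> (u', v') \<in> parcs C \<Longrightarrow>
       u = u' \<or> (u, u') \<in> parcs C \<Longrightarrow> h b u v = h b u' v' \<Longrightarrow> {u, v} = {u', v'}" and
    h_neq: "\<And>b u v v'. (u, v) \<in> parcs C \<Longrightarrow> (u, v') \<in> parcs C \<Longrightarrow> h b u v \<noteq> h (\<not> b) u v'"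
    unfolding C_def by (rule fibre_coloring_short_odd_cycle) blast
  \<comment> \<open>The label of a vertex is its star together with a bit that flips along every
    tree edge and selects the table of its fibre.\<close>
  define R where "R i s s' \<longleftrightarrow> linked C d i (fst s) (fst s') \<and> snd s' = (\<not> snd s)"
    for i :: nat and s s' :: "(nat \<Rightarrow> nat \<Rightarrow> nat) \<times> bool"
  have states: "\<Sigma> \<times> UNIV \<noteq> {}"
    using \<Sigma> by (auto simp: star_system_def)
  have R: "\<exists>s'\<in>\<Sigma> \<times> UNIV. R i s s'" if "s \<in> \<Sigma> \<times> UNIV" "i < d" for s i
    using \<Sigma> that by (fastforce simp: star_system_def R_def)
  have R_sym: "R i s' s" if "R i s s'" for i s s'
    using that by (auto simp: R_def intro: linked_sym)
  obtain \<sigma> :: "'a \<Rightarrow> (nat \<Rightarrow> nat \<Rightarrow> nat) \<times> bool" and \<iota> where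
    \<sigma>: "\<And>a. a \<in> pverts T \<Longrightarrow> \<sigma> a \<in> \<Sigma> \<times> UNIV" and
    \<iota>: "\<And>a b. (a, b) \<in> parcs T \<Longrightarrow> \<iota> a b < d \<and> \<iota> b a = \<iota> a b \<and> R (\<iota> a b) (\<sigma> a) (\<sigma> b)" and
    \<iota>_inj: "\<And>a b b'. (a, b) \<in> parcs T \<Longrightarrow> (a, b') \<in> parcs T \<Longrightarrow> \<iota> a b = \<iota> a b' \<Longrightarrow> b = b'"
    by (rule tree_labelling[where R = R, OF assms(1) eq_refl[OF d_def[symmetric]] states R R_sym])
      (assumption+, rule that)
  define c where "c a = fst (\<sigma> a)" for a
  have star: "star C d k (c a)" if "a \<in> pverts T" for a
    using \<Sigma> \<sigma>[OF that] by (auto simp: star_system_def c_def)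
  have linked: "c a j u = c b j' u \<longleftrightarrow> j = \<iota> a b \<and> j' = \<iota> a b"
    if "(a, b) \<in> parcs T" "u \<in> pverts C" "j < d" "j' < d" for a b u j j'
    using \<iota>[OF that(1)] that(2-4) by (auto simp: R_def linked_def c_def)
  have parity: "snd (\<sigma> b) = (\<not> snd (\<sigma> a))" if "(a, b) \<in> parcs T" for a b
    using \<iota>[OF that] by (simp add: R_def)
  \<comment> \<open>Arcs within a layer get star colours below \<open>k\<close>; fibre arcs get the
    six colours from \<open>k\<close> on.\<close>
  define \<phi> where "\<phi> x y = (if snd x = snd y then c (fst x) (\<iota> (fst x) (fst y)) (snd x)
      else k + h (snd (\<sigma> (fst x))) (snd x) (snd y))" for x y :: "'a \<times> nat"
  have \<phi>_T: "\<phi> (a, u) (b, u) = c a (\<iota> a b) u" for a b u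
    by (simp add: \<phi>_def)
  have \<phi>_C: "\<phi> (a, u) (a, v) = k + h (snd (\<sigma> a)) u v" if "(u, v) \<in> parcs C" for a u v
    using that C_loop by (auto simp: \<phi>_def)
  have \<phi>_less: "c a (\<iota> a b) u < k" if "(a, b) \<in> parcs T" "u \<in> pverts C" for a b u
    using star_less[OF star] T_verts[OF that(1)] \<iota>[OF that(1)] that(2) by blast
  have "strong_chromatic_index (T \<box> C) \<le> k + 6"
  proof (rule strong_chromatic_index_le[where \<phi> = \<phi>])
    show "pair_graph (T \<box> C)"
      by (rule pair_graph_cartesian_product) unfold_locales
    fix x y assume xy: "(x, y) \<in> parcs (T \<box> C)"
    show "\<phi> x y = \<phi> y x"
      using xy
    proof (cases rule: cartesian_product_arc_cases)
      case (fst a b u)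
      \<comment> \<open>Both ends see the same colour, since linked stars agree at the index of
        their edge.\<close>
      then show ?thesis
        using linked[of a b u "\<iota> a b" "\<iota> a b"] \<iota>[of a b] by (simp add: \<phi>_T)
    next
      case (snd a u v)
      then show ?thesis
        using C_loop[of u] h_sym[OF snd(3), of "snd (\<sigma> a)"] by (auto simp: \<phi>_def)
    qed
    show "\<phi> x y < k + 6"
      using xy
    proof (cases rule: cartesian_product_arc_cases)
      case (fst a b u)
      then show ?thesis
        using \<phi>_less[of a b u] by (simp add: \<phi>_T)
    next
      case (snd a u v)
      then show ?thesis
        using h_less by (simp add: \<phi>_C)
    qed
    fix x' y' assume xy': "(x', y') \<in> parcs (T \<box> C)"
      and adj: "x = x' \<or> (x, x') \<in> parcs (T \<box> C)" and eq: "\<phi> x y = \<phi> x' y'"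
    show "{x, y} = {x', y'}"
      using xy
    proof (cases rule: cartesian_product_arc_cases)
      case (fst a b u)
      note xy = fst
      show ?thesis
        using xy'
      proof (cases rule: cartesian_product_arc_cases)
        case (fst a' b' u')
        have eq': "c a (\<iota> a b) u = c a' (\<iota> a' b') u'"
          using eq xy fst by (simp add: \<phi>_T)
        have lt: "\<iota> a b < d" "\<iota> a' b' < d"
          using \<iota> xy(3) fst(3) by auto
        have "a = a' \<and> u = u' \<or> a = a' \<and> (u, u') \<in> parcs C \<or> (a, a') \<in> parcs T \<and> u = u'"
          using adj xy fst by (auto simp: cartesian_product_def)
        then consider "a = a'" "u = u'" | "a = a'" "(u, u') \<in> parcs C" | "(a, a') \<in> parcs T" "u = u'"
          by blast
        then show ?thesis
        proof cases
          case 1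
          then have "\<iota> a b = \<iota> a b'"
            using eq' star_eq_iff[OF star] lt xy(3,4) T_verts by simp
          then show ?thesis
            using \<iota>_inj[OF xy(3), of b'] xy fst 1 by simp
        next
          case 2
          then show ?thesis
            using eq' star_adj[OF star[OF T_verts[OF xy(3)]] lt] by simp
        next
          case 3
          \<comment> \<open>Adjacent stars share in this layer only the colour of the edge between
            \<open>a\<close> and \<open>a'\<close>, so both edges are that one.\<close>
          then have "\<iota> a b = \<iota> a a'" "\<iota> a' b' = \<iota> a a'"
            using eq' linked[OF 3(1) xy(4) lt] by auto
          then have "b = a'" "b' = a"
            using \<iota>_inj[OF xy(3) 3(1)] \<iota>_inj[OF fst(3) arc_sym[OF 3(1)]] \<iota>[OF 3(1)] by auto
          then show ?thesis
            using 3 xy fst by auto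
        qed
      next
        case (snd a' u' v')
        then show ?thesis
          using eq xy \<phi>_less[of a b u] by (simp add: \<phi>_T \<phi>_C)
      qed
    next
      case (snd a u v)
      note xy = snd
      show ?thesis
        using xy'
      proof (cases rule: cartesian_product_arc_cases)
        case (fst a' b' u')
        then show ?thesis
          using eq xy \<phi>_less[of a' b' u'] by (simp add: \<phi>_T \<phi>_C)
      next
        case (snd a' u' v')
        have eq': "h (snd (\<sigma> a)) u v = h (snd (\<sigma> a')) u' v'"
          using eq xy snd by (simp add: \<phi>_C)
        have "a = a' \<and> (u = u' \<or> (u, u') \<in> parcs C) \<or> (a, a') \<in> parcs T \<and> u = u'"
          using adj xy snd by (auto simp: cartesian_product_def)
        then consider "a = a'" "u = u' \<or> (u, u') \<in> parcs C" | "(a, a') \<in> parcs T" "u = u'"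
          by blast
        then show ?thesis
        proof cases
          case 1
          then have "{u, v} = {u', v'}"
            using h_strong[OF xy(3) snd(3)] eq' by blast
          then show ?thesis
            using xy snd 1 by (auto simp: doubleton_eq_iff)
        next
          case 2
          \<comment> \<open>Fibres over adjacent tree vertices use opposite tables, whose colours at
            a common layer differ.\<close>
          then show ?thesis
            using h_neq[of u v v' "snd (\<sigma> a)"] eq' parity[OF 2(1)] xy snd by simp
        qed
      qed
    qed
  qed
  moreover have "\<lceil>real d / real l\<rceil> = int ((d + l - 1) div l)"
    using assms(2) by (intro ceiling_divide_nat) auto
  ultimately show ?thesis
    unfolding C_def d_def[symmetric] k_def by simp
qed

end
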